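(* Let $G$ be a $\Gamma$-AG-groupoid that contains a left identity $e$. Then $G$ is an AG-groupoid with left identity; that is, $a\alpha b = a\beta b$ for all $a,b\in G$ and all $\alpha,\beta\in\Gamma$, so that all the elements of $\Gamma$ define one and the same binary operation on $G$, and $G$ with this operation is an AG-groupoid with left identity.
   Context: Let $G$ and $\Gamma$ be non-empty sets. $G$ is a $\Gamma$-AG-groupoid if there is a mapping $G\times\Gamma\times G\to G$, written $(a,\gamma,b)\mapsto a\gamma b$, such that $(a\gamma b)\delta c=(c\gamma b)\delta a$ for all $a,b,c\in G$ and $\gamma,\delta\in\Gamma$. An element $e\in G$ is a left identity of the $\Gamma$-AG-groupoid $G$ if $e\gamma a=a$ for all $a\in G$ and all $\gamma\in\Gamma$. An AG-groupoid (also called LA-semigroup) is a set with a binary operation satisfying $(ab)c=(cb)a$ for all $a,b,c$; a left identity in it is an element $e$ with $ea=a$ for all $a$. *)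

theory Defs
  imports Main
begin

text \<open>
  The product \<open>mul a \<gamma> b\<close> stands for \<open>a\<gamma>b\<close>; only its values for
  \<open>a, b \<in> G\<close> and \<open>\<gamma> \<in> \<Gamma>\<close> are constrained.
\<close>

locale gamma_AG_groupoid =
  fixes G :: "'a set"
    and \<Gamma> :: "'g set"
    and mul :: "'a \<Rightarrow> 'g \<Rightarrow> 'a \<Rightarrow> 'a"
  assumes G_nonempty: "G \<noteq> {}"
    and Gamma_nonempty: "\<Gamma> \<noteq> {}"
    and mul_closed: "\<lbrakk>a \<in> G; \<gamma> \<in> \<Gamma>; b \<in> G\<rbrakk> \<Longrightarrow> mul a \<gamma> b \<in> G"
    and left_invertive:
      "\<lbrakk>a \<in> G; b \<in> G; c \<in> G; \<gamma> \<in> \<Gamma>; \<delta> \<in> \<Gamma>\<rbrakk>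
        \<Longrightarrow> mul (mul a \<gamma> b) \<delta> c = mul (mul c \<gamma> b) \<delta> a"

definition gamma_left_identity ::
    "'a set \<Rightarrow> 'g set \<Rightarrow> ('a \<Rightarrow> 'g \<Rightarrow> 'a \<Rightarrow> 'a) \<Rightarrow> 'a \<Rightarrow> bool" where
  "gamma_left_identity G \<Gamma> mul e \<longleftrightarrow> e \<in> G \<and> (\<forall>a\<in>G. \<forall>\<gamma>\<in>\<Gamma>. mul e \<gamma> a = a)"

locale AG_groupoid =
  fixes G :: "'a set"
    and opr :: "'a \<Rightarrow> 'a \<Rightarrow> 'a"
  assumes opr_closed: "\<lbrakk>a \<in> G; b \<in> G\<rbrakk> \<Longrightarrow> opr a b \<in> G"
    and left_invertive:
      "\<lbrakk>a \<in> G; b \<in> G; c \<in> G\<rbrakk> \<Longrightarrow> opr (opr a b) c = opr (opr c b) a"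

definition left_identity :: "'a set \<Rightarrow> ('a \<Rightarrow> 'a \<Rightarrow> 'a) \<Rightarrow> 'a \<Rightarrow> bool" where
  "left_identity G opr e \<longleftrightarrow> e \<in> G \<and> (\<forall>a\<in>G. opr e a = a)"

end

theory Submission
  imports Defs
begin

text \<open>
  Let \<open>e\<close> be the left identity. The left invertive law gives \<open>a\<delta>b = (e\<gamma>a)\<delta>b = (b\<gamma>a)\<delta>e\<close>, so every
  product is a right translate by \<open>e\<close>, and the inner symbol \<open>\<gamma>\<close> can be chosen freely. It is thus
  enough that right translation by \<open>e\<close> does not depend on the element of \<open>\<Gamma>\<close>
  (\<open>right_mul_left_identity_indep\<close>). Taking \<open>a = e\<close> in the formula above gives \<open>(b\<gamma>e)\<delta>e = b\<close> for all
  \<open>\<gamma>\<close>, \<open>\<delta>\<close>: any two of these translations are inverse to each other, each one is its own inverse, and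
  so they all coincide.
\<close>

context gamma_AG_groupoid
begin

lemma mul_eq_swap_mul_left_identity:
  assumes "gamma_left_identity G \<Gamma> mul e" "a \<in> G" "b \<in> G" "\<gamma> \<in> \<Gamma>" "\<delta> \<in> \<Gamma>"
  shows "mul a \<delta> b = mul (mul b \<gamma> a) \<delta> e"
proof -
  have "mul a \<delta> b = mul (mul e \<gamma> a) \<delta> b"
    using assms by (simp add: gamma_left_identity_def)
  also have "\<dots> = mul (mul b \<gamma> a) \<delta> e"
    using assms by (intro left_invertive) (auto simp: gamma_left_identity_def)
  finally show ?thesis .
qed

lemma right_mul_left_identity_cancel:
  assumes "gamma_left_identity G \<Gamma> mul e" "a \<in> G" "\<gamma> \<in> \<Gamma>" "\<delta> \<in> \<Gamma>"
  shows "mul (mul a \<gamma> e) \<delta> e = a"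
  using mul_eq_swap_mul_left_identity[of e e a \<gamma> \<delta>] assms
  by (simp add: gamma_left_identity_def)

text \<open>
  The element \<open>((a\<alpha>e)\<alpha>e)\<beta>e\<close> can be cancelled at the inner pair of translations, which leaves \<open>a\<beta>e\<close>,
  or at the outer pair, which leaves \<open>a\<alpha>e\<close>.
\<close>
lemma right_mul_left_identity_indep:
  assumes e: "gamma_left_identity G \<Gamma> mul e" and "a \<in> G" "\<alpha> \<in> \<Gamma>" "\<beta> \<in> \<Gamma>"
  shows "mul a \<alpha> e = mul a \<beta> e"
proof -
  have "mul a \<alpha> e \<in> G"
    using assms by (auto simp: gamma_left_identity_def intro: mul_closed)
  then have "mul a \<alpha> e = mul (mul (mul a \<alpha> e) \<alpha> e) \<beta> e"
    using right_mul_left_identity_cancel[OF e] assms(3,4) by metis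
  also have "\<dots> = mul a \<beta> e"
    using right_mul_left_identity_cancel[OF e] assms by simp
  finally show ?thesis .
qed

lemma mul_indep:
  assumes e: "gamma_left_identity G \<Gamma> mul e"
    and "a \<in> G" "b \<in> G" "\<alpha> \<in> \<Gamma>" "\<beta> \<in> \<Gamma>"
  shows "mul a \<alpha> b = mul a \<beta> b"
proof -
  have "mul a \<alpha> b = mul (mul b \<alpha> a) \<alpha> e"
    using assms by (intro mul_eq_swap_mul_left_identity)
  also have "\<dots> = mul (mul b \<alpha> a) \<beta> e"
    using assms by (intro right_mul_left_identity_indep[OF e] mul_closed)
  also have "\<dots> = mul a \<beta> b"
    using assms by (intro mul_eq_swap_mul_left_identity[symmetric])
  finally show ?thesis .
qed

lemma AG_groupoid_mul:
  assumes "\<gamma> \<in> \<Gamma>"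
  shows "AG_groupoid G (\<lambda>a b. mul a \<gamma> b)"
  using assms by unfold_locales (auto intro: mul_closed left_invertive)

end

theorem lemma1:
  fixes G :: "'a set"
    and \<Gamma> :: "'g set"
    and mul :: "'a \<Rightarrow> 'g \<Rightarrow> 'a \<Rightarrow> 'a"
    and e :: 'a
  assumes "gamma_AG_groupoid G \<Gamma> mul"
    and "gamma_left_identity G \<Gamma> mul e"
  shows "(\<forall>a\<in>G. \<forall>b\<in>G. \<forall>\<alpha>\<in>\<Gamma>. \<forall>\<beta>\<in>\<Gamma>. mul a \<alpha> b = mul a \<beta> b) \<and>
    (\<exists>opr. (\<forall>\<gamma>\<in>\<Gamma>. \<forall>a\<in>G. \<forall>b\<in>G. mul a \<gamma> b = opr a b) \<and>
      AG_groupoid G opr \<and> (\<exists>e'. left_identity G opr e'))"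
proof -
  interpret gamma_AG_groupoid G \<Gamma> mul
    by (fact assms(1))
  obtain \<gamma> where \<gamma>: "\<gamma> \<in> \<Gamma>"
    using Gamma_nonempty by blast
  have indep: "\<forall>a\<in>G. \<forall>b\<in>G. \<forall>\<alpha>\<in>\<Gamma>. \<forall>\<beta>\<in>\<Gamma>. mul a \<alpha> b = mul a \<beta> b"
    using mul_indep[OF assms(2)] by blast
  moreover have "left_identity G (\<lambda>a b. mul a \<gamma> b) e"
    using assms(2) \<gamma> by (simp add: gamma_left_identity_def left_identity_def)
  moreover have "\<forall>\<delta>\<in>\<Gamma>. \<forall>a\<in>G. \<forall>b\<in>G. mul a \<delta> b = (\<lambda>a b. mul a \<gamma> b) a b"
    using indep \<gamma> by blast
  ultimately show ?thesis
    using AG_groupoid_mul[OF \<gamma>] by (intro conjI exI[of _ "\<lambda>a b. mul a \<gamma> b"] exI[of _ e]) simp_all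
qed

end
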